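(* There is an absolute constant $C>0$ such that the following holds. For all integers $n\ge 2$, every prime power $q$, every $\gamma\in(0,1)$, and every integer $m\ge C\left(1+\frac{\log(q/\gamma)}{\log n}\right)$: for every $\mathbf{x}\in\mathbb{F}_q^n$, $\mathrm{SD}\big(\mathcal{S}_{\mathbf{x}},\,\mathcal{U}_{x_1+\cdots+x_n}\big)\le\gamma$.
   Context: $\mathbb{F}_q$ is the finite field with $q$ elements and $\mathrm{SD}$ denotes statistical (total variation) distance. For $\mathbf{x}\in\mathbb{F}_q^n$, $\mathcal{S}_{\mathbf{x}}$ is the distribution on $\mathbb{F}_q^{mn}$ obtained by sampling, independently for each $i\in[n]$, $y_{m(i-1)+1},\dots,y_{mi}\in\mathbb{F}_q$ uniformly at random conditioned on $y_{m(i-1)+1}+\cdots+y_{mi}=x_i$, then sampling a uniformly random permutation $\pi$ of $[mn]$ and outputting $(y_{\pi(1)},\dots,y_{\pi(mn)})$. For $a\in\mathbb{F}_q$, $\mathcal{U}_a$ is the uniform distribution on the set of vectors in $\mathbb{F}_q^{mn}$ whose coordinates sum to $a$. *)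

theory Defs
  imports "HOL-Algebra.Ring" "HOL-Probability.Probability_Mass_Function"
    "HOL-Combinatorics.Permutations" "HOL-Library.FuncSet" "HOL-Analysis.Infinite_Sum"
begin

definition vecs :: "nat ring \<Rightarrow> nat \<Rightarrow> (nat \<Rightarrow> nat) set" where
  "vecs F N = ({..<N} \<rightarrow>\<^sub>E carrier F)"

definition block_vecs :: "nat ring \<Rightarrow> nat \<Rightarrow> nat \<Rightarrow> (nat \<Rightarrow> nat) \<Rightarrow> (nat \<Rightarrow> nat) set" where
  "block_vecs F m n x = {y \<in> vecs F (m * n).
      \<forall>i<n. finsum F y {m * i ..< m * i + m} = x i}"

definition S_dist :: "nat ring \<Rightarrow> nat \<Rightarrow> nat \<Rightarrow> (nat \<Rightarrow> nat) \<Rightarrow> (nat \<Rightarrow> nat) pmf" where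
  "S_dist F m n x =
     map_pmf (\<lambda>(y, \<pi>). restrict (\<lambda>j. y (\<pi> j)) {..<m * n})
       (pair_pmf (pmf_of_set (block_vecs F m n x))
                 (pmf_of_set {\<pi>. \<pi> permutes {..<m * n}}))"

definition U_dist :: "nat ring \<Rightarrow> nat \<Rightarrow> nat \<Rightarrow> (nat \<Rightarrow> nat) pmf" where
  "U_dist F N a = pmf_of_set {v \<in> vecs F N. finsum F v {..<N} = a}"

definition stat_dist :: "'a pmf \<Rightarrow> 'a pmf \<Rightarrow> real" where
  "stat_dist p q = (1/2) * infsum (\<lambda>v. \<bar>pmf p v - pmf q v\<bar>) UNIV"

end

theory Submission
  imports Defs "HOL-Combinatorics.Multiset_Permutations"
begin

text \<open>By Cauchy--Schwarz it suffices to bound the collision probability of \<open>S_dist\<close>. Writing \<open>q\<close> for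
  the size of the field and \<open>B\<close> for \<open>block_vecs\<close>, collisions are counted by the sum over all permutations
  \<open>\<sigma>\<close> of the number of \<open>y \<in> B\<close> with \<open>y \<circ> \<sigma> \<in> B\<close>. Such \<open>y\<close> label the edges of a random
  \<open>m\<close>-regular bipartite multigraph on \<open>n + n\<close> vertices, with prescribed sums at all vertices. Adding the
  edges one by one shows that there are at most \<open>q ^ (m * n - 2 * n + k)\<close> of them, where \<open>k\<close> is the number
  of connected components, and \<open>q ^ k\<close> is the number of \<open>q\<close>-colourings that are constant on components.

  Exchanging summations, a pair of colour sequences with the same multiset of colours \<open>A\<close> is respected by
  a fraction \<open>1 / M (m A) \<le> 1 / M A ^ m\<close> of the permutations, where \<open>M\<close> is the multinomial
  coefficient. So the expectation of \<open>q ^ k\<close> is at most the sum of \<open>M A ^ (2 - m)\<close> over multisets \<open>A\<close> of size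
  \<open>n\<close>. The \<open>q\<close> monochromatic multisets contribute \<open>q\<close>. There are at most \<open>(q n) ^ r\<close> multisets with
  \<open>r\<close> distinct colours, and these satisfy \<open>M A ^ 2 \<ge> n ^ (r - 1)\<close>, so the rest of the sum is
  a geometric series, which is at most \<open>\<gamma>\<^sup>2 q\<close>.\<close>

subsection \<open>Edge labellings with prescribed vertex sums\<close>

lemma (in abelian_monoid) finsum_fibres:
  assumes "finite E" "finite A" "z \<in> E \<rightarrow> carrier G"
  shows "finsum G (\<lambda>i. finsum G z {e \<in> E. l e = i}) A = finsum G z {e \<in> E. l e \<in> A}"
proof -
  have "finsum G z (\<Union>i\<in>A. {e \<in> E. l e = i}) = finsum G (\<lambda>i. finsum G z {e \<in> E. l e = i}) A"
    by (rule add.finprod_UN_disjoint) (use assms in \<open>auto simp: pairwise_def disjnt_def\<close>)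
  moreover have "(\<Union>i\<in>A. {e \<in> E. l e = i}) = {e \<in> E. l e \<in> A}"
    by auto
  ultimately show ?thesis by simp
qed

text \<open>A pair of maps \<open>l, r\<close> from the edges \<open>{..<N}\<close> to \<open>{..<n}\<close> encodes a bipartite
  multigraph with \<open>n\<close> vertices on either side; \<open>b\<close> and \<open>c\<close> prescribe the sums of the edge labels
  at the left and the right vertices. A colouring assigns equal colours to adjacent vertices, so there are
  \<open>card S ^ k\<close> of them, where \<open>k\<close> is the number of connected components.\<close>

definition flows ::
  "('a, 'm) ring_scheme \<Rightarrow> nat \<Rightarrow> (nat \<Rightarrow> nat) \<Rightarrow> (nat \<Rightarrow> nat) \<Rightarrow> nat \<Rightarrow> (nat \<Rightarrow> 'a) \<Rightarrow> (nat \<Rightarrow> 'a) \<Rightarrow> (nat \<Rightarrow> 'a) set"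
  where "flows G n l r N b c = {z \<in> {..<N} \<rightarrow>\<^sub>E carrier G.
     (\<forall>i<n. finsum G z {e \<in> {..<N}. l e = i} = b i) \<and> (\<forall>i<n. finsum G z {e \<in> {..<N}. r e = i} = c i)}"

definition colourings ::
  "'a set \<Rightarrow> nat \<Rightarrow> (nat \<Rightarrow> nat) \<Rightarrow> (nat \<Rightarrow> nat) \<Rightarrow> nat \<Rightarrow> ((nat \<Rightarrow> 'a) \<times> (nat \<Rightarrow> 'a)) set"
  where "colourings S n l r N =
    {(f, g). f \<in> {..<n} \<rightarrow>\<^sub>E S \<and> g \<in> {..<n} \<rightarrow>\<^sub>E S \<and> (\<forall>e<N. f (l e) = g (r e))}"

lemma finite_colourings: "finite S \<Longrightarrow> finite (colourings S n l r N)"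
  by (rule finite_subset[of _ "({..<n} \<rightarrow>\<^sub>E S) \<times> ({..<n} \<rightarrow>\<^sub>E S)"])
     (auto simp: colourings_def intro!: finite_PiE)

lemma finite_flows: "finite (carrier G) \<Longrightarrow> finite (flows G n l r N b c)"
  by (rule finite_subset[of _ "{..<N} \<rightarrow>\<^sub>E carrier G"]) (auto simp: flows_def intro!: finite_PiE)

text \<open>Edge \<open>N\<close> merges at most two components, which costs at most a factor
  \<open>card S\<close>. Components are never formed explicitly: one colouring that separates the
  ends of the edge serves to repair all the others, and recording the old colour of
  \<open>l N\<close> makes the repair reversible.\<close>

lemma card_colourings_le_Suc:
  assumes "finite S" "l N < n" "r N < n" and l: "\<And>e. e < N \<Longrightarrow> l e < n \<and> r e < n"
  shows "card (colourings S n l r N) \<le> card S * card (colourings S n l r (Suc N))"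
proof (cases "\<exists>(f,g)\<in>colourings S n l r N. f (l N) \<noteq> g (r N)")
  case False
  then have "f (l N) = g (r N)" if "(f, g) \<in> colourings S n l r N" for f g
    using that by auto
  then have "colourings S n l r (Suc N) = colourings S n l r N"
    unfolding colourings_def by (auto simp: less_Suc_eq)
  moreover have "card S > 0" if "(f, g) \<in> colourings S n l r N" for f g
    using that assms(1,2) by (auto simp: colourings_def card_gt_0_iff)
  ultimately show ?thesis
    by (cases "colourings S n l r N = {}") auto
next
  case True
  then obtain f0 g0 where 0: "(f0,g0) \<in> colourings S n l r N" "f0 (l N) \<noteq> g0 (r N)" by auto
  define a where "a = f0 (l N)"
  \<comment> \<open>The vertices coloured \<open>a\<close> form a union of components that contains \<open>l N\<close> but not \<open>r N\<close>.
    Swapping two colours on it makes the colours at the ends of edge \<open>N\<close> agree.\<close>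
  define \<tau> where "\<tau> = (\<lambda>(f::nat \<Rightarrow> 'a,g::nat \<Rightarrow> 'a). Transposition.transpose (f (l N)) (g (r N)))"
  define F where "F = (\<lambda>(f::nat \<Rightarrow> 'a,g::nat \<Rightarrow> 'a).
     ((\<lambda>i\<in>{..<n}. if f0 i = a then \<tau> (f,g) (f i) else f i),
      (\<lambda>i\<in>{..<n}. if g0 i = a then \<tau> (f,g) (g i) else g i)))"
  have "card (colourings S n l r N) \<le> card (S \<times> colourings S n l r (Suc N))"
  proof (rule card_inj_on_le)
    show "inj_on (\<lambda>p. (fst p (l N), F p)) (colourings S n l r N)"
    proof (rule inj_onI, clarsimp)
      fix f g f' g'
      assume 1: "(f,g) \<in> colourings S n l r N" "(f',g') \<in> colourings S n l r N"
        and 2: "f (l N) = f' (l N)" and 3: "F (f, g) = F (f', g')"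
      \<comment> \<open>Since \<open>g0 (r N)\<close> differs from \<open>a\<close>, the recolouring
        keeps the colour of \<open>r N\<close>. With the recorded colour of \<open>l N\<close> this
        determines the transposition, which can then be undone.\<close>
      have "snd (F (f, g)) (r N) = snd (F (f', g')) (r N)" using 3 by simp
      then have g: "g (r N) = g' (r N)"
        using 0 assms by (simp add: F_def a_def)
      have \<tau>: "\<tau> (f', g') = \<tau> (f, g)" using 2 g by (simp add: \<tau>_def)
      have \<tau>_inj: "x = y" if "\<tau> (f, g) x = \<tau> (f, g) y" for x y
        using that by (auto simp: \<tau>_def transpose_eq_iff)
      have "f i = f' i" for i
      proof (cases "i < n")
        case True
        have "fst (F (f, g)) i = fst (F (f', g')) i" using 3 by simp
        then show ?thesis using True
          by (auto simp: F_def \<tau> dest!: \<tau>_inj split: if_splits)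
      qed (use 1 in \<open>auto simp: colourings_def PiE_def extensional_def\<close>)
      moreover have "g i = g' i" for i
      proof (cases "i < n")
        case True
        have "snd (F (f, g)) i = snd (F (f', g')) i" using 3 by simp
        then show ?thesis using True
          by (auto simp: F_def \<tau> dest!: \<tau>_inj split: if_splits)
      qed (use 1 in \<open>auto simp: colourings_def PiE_def extensional_def\<close>)
      ultimately show "f = f' \<and> g = g'" by auto
    qed
    show "(\<lambda>p. (fst p (l N), F p)) ` colourings S n l r N \<subseteq> S \<times> colourings S n l r (Suc N)"
    proof (rule image_subsetI)
      fix p assume p: "p \<in> colourings S n l r N"
      obtain f g where fg: "p = (f, g)" by fastforce
      have S: "f i \<in> S" "g i \<in> S" if "i < n" for i
        using p that by (auto simp: fg colourings_def)
      have *: "f (l e) = g (r e)" if "e < N" for e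
        using p that by (auto simp: fg colourings_def)
      have 1: "f0 (l e) = a \<longleftrightarrow> g0 (r e) = a" if "e < N" for e
        using 0(1) that by (auto simp: colourings_def)
      have \<tau>S: "\<tau> (f, g) x \<in> S" if "x \<in> S" for x
        using that S(1)[OF assms(2)] S(2)[OF assms(3)] by (simp add: \<tau>_def Transposition.transpose_def)
      have "fst (F (f, g)) (l e) = snd (F (f, g)) (r e)" if "e < Suc N" for e
      proof (cases "e = N")
        case True
        then show ?thesis using 0(2) assms(2,3) by (simp add: F_def a_def \<tau>_def)
      next
        case False
        then have "e < N" using that by simp
        then show ?thesis using 1[of e] *[of e] l[of e] by (simp add: F_def)
      qed
      moreover have "fst (F (f, g)) \<in> {..<n} \<rightarrow>\<^sub>E S" "snd (F (f, g)) \<in> {..<n} \<rightarrow>\<^sub>E S"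
        using S \<tau>S by (auto simp: F_def)
      ultimately have "F (f, g) \<in> colourings S n l r (Suc N)"
        by (simp add: colourings_def case_prod_beta)
      then show "(fst p (l N), F p) \<in> S \<times> colourings S n l r (Suc N)"
        using S assms by (simp add: fg)
    qed
  qed (simp add: assms(1) finite_colourings)
  then show ?thesis by (simp add: card_cartesian_product)
qed

section \<open>Counting flows edge by edge\<close>

context abelian_group
begin

lemma restrict_flows_Suc:
  assumes "z \<in> flows G n l r (Suc N) b c" "l N < n" "r N < n"
  shows "restrict z {..<N} \<in> flows G n l r N (b(l N := b (l N) \<ominus> z N)) (c(r N := c (r N) \<ominus> z N))"
proof -
  have zG: "z e \<in> carrier G" if "e < Suc N" for e
    using assms(1) that by (auto simp: flows_def)
  have *: "finsum G (restrict z {..<N}) {e \<in> {..<N}. h e = i} = (d(h N := d (h N) \<ominus> z N)) i"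
    if d: "finsum G z {e \<in> {..<Suc N}. h e = i} = d i" for h :: "nat \<Rightarrow> nat" and d i
  proof -
    let ?E = "{e \<in> {..<N}. h e = i}"
    have E: "{e \<in> {..<Suc N}. h e = i} = (if h N = i then insert N ?E else ?E)"
      by (auto simp: less_Suc_eq)
    have r: "finsum G (restrict z {..<N}) ?E = finsum G z ?E"
      by (rule finsum_cong') (use zG in auto)
    have s: "finsum G z ?E \<in> carrier G"
      by (rule finsum_closed) (use zG in auto)
    show ?thesis
    proof (cases "h N = i")
      case True
      have "finsum G z (insert N ?E) = z N \<oplus> finsum G z ?E"
        by (rule finsum_insert) (use zG in auto)
      then have "d i = z N \<oplus> finsum G z ?E" using d E True by simp
      then show ?thesis using True r s zG[of N]
        by (simp add: a_minus_def a_ac r_neg1 r_neg2)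
    qed (use d E r in simp)
  qed
  show ?thesis
    using assms(1) * zG unfolding flows_def by (auto simp del: fun_upd_apply)
qed

text \<open>A flow is recovered from its last label and its restriction, which is a flow for sums
  lowered at both ends of the edge. These sums depend on the label, hence a bound \<open>k\<close>
  uniform in \<open>b\<close> and \<open>c\<close>.\<close>

lemma card_flows_Suc:
  assumes "finite (carrier G)" "l N < n" "r N < n"
    and le: "\<And>b c. card (flows G n l r N b c) \<le> k"
  shows "card (flows G n l r (Suc N) b c) \<le> card ((\<lambda>z. z N) ` flows G n l r (Suc N) b c) * k"
proof -
  let ?Z = "flows G n l r (Suc N) b c"
  let ?Y = "\<lambda>t. flows G n l r N (b(l N := b (l N) \<ominus> t)) (c(r N := c (r N) \<ominus> t))"
  note fin = finite_flows[OF assms(1)]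
  have "card ?Z \<le> card (Sigma ((\<lambda>z. z N) ` ?Z) ?Y)"
  proof (rule card_inj_on_le)
    show "inj_on (\<lambda>z. (z N, restrict z {..<N})) ?Z"
    proof (rule inj_onI, rule ext)
      fix z z' e
      assume z: "z \<in> ?Z" "z' \<in> ?Z" and eq: "(z N, restrict z {..<N}) = (z' N, restrict z' {..<N})"
      consider "e < N" | "e = N" | "e \<ge> Suc N" by linarith
      then show "z e = z' e"
      proof cases
        case 1
        have "restrict z {..<N} e = restrict z' {..<N} e" using eq by simp
        then show ?thesis using 1 by simp
      qed (use z eq in \<open>auto simp: flows_def PiE_def extensional_def\<close>)
    qed
    show "(\<lambda>z. (z N, restrict z {..<N})) ` ?Z \<subseteq> Sigma ((\<lambda>z. z N) ` ?Z) ?Y"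
      using restrict_flows_Suc assms(2,3) by (fastforce simp del: fun_upd_apply)
    show "finite (Sigma ((\<lambda>z. z N) ` ?Z) ?Y)"
      using fin by (intro finite_SigmaI finite_imageI) auto
  qed
  also have "\<dots> = (\<Sum>t\<in>(\<lambda>z. z N) ` ?Z. card (?Y t))"
    using fin by (intro card_SigmaI) auto
  also have "\<dots> \<le> card ((\<lambda>z. z N) ` ?Z) * k"
    using sum_bounded_above[of "(\<lambda>z. z N) ` ?Z" "\<lambda>t. card (?Y t)" k] le by simp
  finally show ?thesis .
qed

text \<open>The vertices coloured \<open>f (l N)\<close> form a union of components of the first
  \<open>N\<close> edges that contains \<open>l N\<close> but not \<open>r N\<close>. Summing labels
  over its left vertices counts its edges and edge \<open>N\<close>; summing over its right vertices
  counts the same edges without \<open>N\<close>.\<close>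

lemma flow_last_determined:
  assumes z: "z \<in> flows G n l r (Suc N) b c"
    and col: "(f, g) \<in> colourings S n l r N" "f (l N) \<noteq> g (r N)"
    and l: "\<And>e. e < Suc N \<Longrightarrow> l e < n \<and> r e < n"
  shows "z N = finsum G b {i \<in> {..<n}. f i = f (l N)} \<ominus> finsum G c {i \<in> {..<n}. g i = f (l N)}"
proof -
  let ?A = "{i \<in> {..<n}. f i = f (l N)}" and ?B = "{i \<in> {..<n}. g i = f (l N)}"
  let ?E = "{e \<in> {..<N}. l e \<in> ?A}"
  have zG: "z e \<in> carrier G" if "e < Suc N" for e
    using z that by (auto simp: flows_def)
  then have zf: "z \<in> {..<Suc N} \<rightarrow> carrier G" by auto
  have zb: "finsum G z {e \<in> {..<Suc N}. l e = i} = b i"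
    and zc: "finsum G z {e \<in> {..<Suc N}. r e = i} = c i" if "i < n" for i
    using z that by (auto simp: flows_def)
  have sG: "finsum G z X \<in> carrier G" if "X \<subseteq> {..<Suc N}" for X
    by (rule finsum_closed) (use zG that in auto)
  have bG: "b i \<in> carrier G" and cG: "c i \<in> carrier G" if "i < n" for i
    using zb[OF that] zc[OF that] sG by (metis (no_types, lifting) mem_Collect_eq subsetI)+
  have "finsum G b ?A = finsum G (\<lambda>i. finsum G z {e \<in> {..<Suc N}. l e = i}) ?A"
    by (rule finsum_cong') (use zb bG in auto)
  also have "\<dots> = finsum G z {e \<in> {..<Suc N}. l e \<in> ?A}"
    by (rule finsum_fibres) (use zf in auto)
  also have "{e \<in> {..<Suc N}. l e \<in> ?A} = insert N ?E"
    using l by (auto simp: less_Suc_eq)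
  also have "finsum G z (insert N ?E) = z N \<oplus> finsum G z ?E"
    by (rule finsum_insert) (use zG in auto)
  finally have b: "finsum G b ?A = z N \<oplus> finsum G z ?E" .
  have "finsum G c ?B = finsum G (\<lambda>i. finsum G z {e \<in> {..<Suc N}. r e = i}) ?B"
    by (rule finsum_cong') (use zc cG in auto)
  also have "\<dots> = finsum G z {e \<in> {..<Suc N}. r e \<in> ?B}"
    by (rule finsum_fibres) (use zf in auto)
  also have "{e \<in> {..<Suc N}. r e \<in> ?B} = ?E"
    using l col by (auto simp: less_Suc_eq colourings_def)
  finally have c: "finsum G c ?B = finsum G z ?E" .
  have "finsum G z ?E \<in> carrier G" by (rule sG) auto
  then show ?thesis
    unfolding b c using zG[of N] by (simp add: a_minus_def a_assoc r_neg del: mem_Collect_eq)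
qed

text \<open>Without edges there is at most one flow. If some colouring separates the ends of a new
  edge, its label is forced and the number of colourings drops by at most the factor
  \<open>card (carrier G)\<close>. Otherwise the colourings stay the same and the label takes at
  most \<open>card (carrier G)\<close> values.\<close>

lemma card_flows_le:
  assumes fin: "finite (carrier G)" and l: "\<And>e. e < N \<Longrightarrow> l e < n \<and> r e < n"
  shows "card (flows G n l r N b c) * card (carrier G) ^ (2 * n)
    \<le> card (carrier G) ^ N * card (colourings (carrier G) n l r N)"
  using l
proof (induction N arbitrary: b c)
  case 0
  have "colourings (carrier G) n l r 0 = ({..<n} \<rightarrow>\<^sub>E carrier G) \<times> ({..<n} \<rightarrow>\<^sub>E carrier G)"
    by (auto simp: colourings_def)
  moreover have "card (flows G n l r 0 b c) \<le> card {\<lambda>_::nat. undefined :: 'a}"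
    by (rule card_mono) (auto simp: flows_def)
  ultimately show ?case by (simp add: card_cartesian_product card_PiE mult_2 power_add)
next
  case (Suc N)
  let ?q = "card (carrier G)" and ?Z = "flows G n l r (Suc N) b c"
  let ?K = "\<lambda>N. card (colourings (carrier G) n l r N)" and ?T = "(\<lambda>z. z N) ` ?Z"
  have q: "?q > 0" using fin by (auto simp: card_gt_0_iff)
  \<comment> \<open>\<open>card_flows_Suc\<close> takes a natural number as bound, so the quotient
    is rounded down; this loses nothing because a cardinality is an integer.\<close>
  have "card (flows G n l r N b c) \<le> ?q ^ N * ?K N div ?q ^ (2 * n)" for b c
    using Suc q by (simp add: less_eq_div_iff_mult_less_eq)
  then have "card ?Z \<le> card ?T * (?q ^ N * ?K N div ?q ^ (2 * n))"
    using Suc.prems fin by (intro card_flows_Suc) auto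
  then have "card ?Z * ?q ^ (2 * n) \<le> card ?T * ((?q ^ N * ?K N div ?q ^ (2 * n)) * ?q ^ (2 * n))"
    by (metis mult.assoc mult_le_mono1)
  also have "\<dots> \<le> card ?T * (?q ^ N * ?K N)"
    by (intro mult_le_mono2) (simp add: div_times_less_eq_dividend)
  also have "\<dots> = ?q ^ N * (card ?T * ?K N)" by (simp add: ac_simps)
  also have "card ?T * ?K N \<le> ?q * ?K (Suc N)"
  proof (cases "\<exists>f g. (f, g) \<in> colourings (carrier G) n l r N \<and> f (l N) \<noteq> g (r N)")
    case True
    then obtain f g where fg: "(f, g) \<in> colourings (carrier G) n l r N" "f (l N) \<noteq> g (r N)" by auto
    have "card ?T \<le> card {finsum G b {i \<in> {..<n}. f i = f (l N)} \<ominus> finsum G c {i \<in> {..<n}. g i = f (l N)}}"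
      by (rule card_mono) (use flow_last_determined[OF _ fg] Suc.prems in auto)
    then have "card ?T * ?K N \<le> 1 * ?K N"
      by (intro mult_le_mono1) simp
    also have "?K N \<le> ?q * ?K (Suc N)"
      using Suc.prems fin by (intro card_colourings_le_Suc) auto
    finally show ?thesis by simp
  next
    case False
    then have "f (l N) = g (r N)" if "(f, g) \<in> colourings (carrier G) n l r N" for f g
      using that by auto
    then have "colourings (carrier G) n l r (Suc N) = colourings (carrier G) n l r N"
      unfolding colourings_def by (auto simp: less_Suc_eq)
    moreover have "card ?T \<le> ?q"
      by (rule card_mono) (use fin in \<open>auto simp: flows_def\<close>)
    ultimately show ?thesis by simp
  qed
  finally show ?case by (simp add: ac_simps)
qed

end

subsection \<open>Multinomial coefficients\<close>

lemma card_permutations_of_multiset_pos: "card (permutations_of_multiset A) > 0"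
  by (simp add: card_gt_0_iff)

text \<open>An arrangement of \<open>A\<close> followed by one of \<open>B\<close> can be split
  again, since its first part has length \<open>size A\<close>.\<close>

lemma card_permutations_of_multiset_mult_le:
  "card (permutations_of_multiset A) * card (permutations_of_multiset B)
    \<le> card (permutations_of_multiset (A + B))"
proof -
  have "card (permutations_of_multiset A \<times> permutations_of_multiset B)
    \<le> card (permutations_of_multiset (A + B))"
  proof (rule card_inj_on_le)
    show "inj_on (\<lambda>(xs, ys). xs @ ys) (permutations_of_multiset A \<times> permutations_of_multiset B)"
      by (auto simp: inj_on_def length_finite_permutations_of_multiset)
    show "(\<lambda>(xs, ys). xs @ ys) ` (permutations_of_multiset A \<times> permutations_of_multiset B)
      \<subseteq> permutations_of_multiset (A + B)"
      by (auto simp: permutations_of_multiset_def)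
  qed simp
  then show ?thesis by (simp add: card_cartesian_product)
qed

lemma card_permutations_of_multiset_power_le:
  "card (permutations_of_multiset A) ^ m \<le> card (permutations_of_multiset (repeat_mset m A))"
proof (induction m)
  case (Suc m)
  have "card (permutations_of_multiset A) ^ Suc m
    \<le> card (permutations_of_multiset A) * card (permutations_of_multiset (repeat_mset m A))"
    using Suc by simp
  also have "\<dots> \<le> card (permutations_of_multiset (repeat_mset (Suc m) A))"
    using card_permutations_of_multiset_mult_le[of A "repeat_mset m A"] by simp
  finally show ?case .
qed simp

text \<open>If \<open>ys\<close> is a rearrangement of \<open>xs\<close>, composing with a fixed
  permutation shows that every other rearrangement is reached by at least as many
  \<open>\<pi>\<close> as \<open>ys\<close>. These classes are disjoint and share the
  \<open>fact (length xs)\<close> permutations.\<close>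

lemma card_permute_list_eq_le:
  "card {\<pi>. \<pi> permutes {..<length xs} \<and> permute_list \<pi> xs = ys}
    * card (permutations_of_multiset (mset xs)) \<le> fact (length xs)"
proof -
  define X where "X ys = {\<pi>. \<pi> permutes {..<length xs} \<and> permute_list \<pi> xs = ys}" for ys
  have fin: "finite (X ys)" for ys
    unfolding X_def by (rule finite_subset[OF _ finite_permutations[of "{..<length xs}"]]) auto
  show ?thesis
  proof (cases "mset ys = mset xs")
    case True
    have "card (X ys) \<le> card (X zs)" if zs: "zs \<in> permutations_of_multiset (mset xs)" for zs
    proof -
      have "mset zs = mset ys" using zs True by (simp add: permutations_of_multiset_def)
      then obtain \<sigma> where \<sigma>: "\<sigma> permutes {..<length ys}" "permute_list \<sigma> ys = zs"
        by (rule mset_eq_permutation)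
      have len: "length ys = length xs" using True by (metis size_mset)
      show ?thesis
      proof (rule card_inj_on_le)
        show "inj_on (\<lambda>\<pi>. \<pi> \<circ> \<sigma>) (X ys)"
          using \<sigma> by (auto simp: inj_on_def dest!: permutes_surj intro!: ext) (metis comp_apply surjD)
        show "(\<lambda>\<pi>. \<pi> \<circ> \<sigma>) ` X ys \<subseteq> X zs"
          using \<sigma> len by (auto simp: X_def permute_list_compose intro: permutes_compose)
      qed (rule fin)
    qed
    then have "card (X ys) * card (permutations_of_multiset (mset xs))
      \<le> (\<Sum>zs\<in>permutations_of_multiset (mset xs). card (X zs))"
      using sum_bounded_below[of "permutations_of_multiset (mset xs)" "card (X ys)" "\<lambda>zs. card (X zs)"]
      by (simp add: mult.commute)
    also have "\<dots> = card (\<Union>zs\<in>permutations_of_multiset (mset xs). X zs)"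
      using fin by (intro card_UN_disjoint[symmetric]) (auto simp: X_def)
    also have "\<dots> \<le> card {\<pi>. \<pi> permutes {..<length xs}}"
      by (intro card_mono finite_permutations) (auto simp: X_def)
    finally show ?thesis by (simp add: X_def card_permutations)
  next
    case False
    then have "X ys = {}" by (auto simp: X_def)
    then have "card (X ys) = 0" by simp
    then show ?thesis unfolding X_def by simp
  qed
qed

section \<open>Multinomial coefficients with many distinct colours are large\<close>

lemma fact_mult_le: 
  assumes "a \<ge> 1" "b \<ge> 1"
  shows "fact a * fact b \<le> (fact (a + b - 1) :: nat)"
proof -
  have "fact (Suc a) * fact (Suc b) \<le> (fact (Suc a + b) :: nat)" for a b
  proof (induction b)
    case (Suc b)
    have "fact (Suc a) * fact (Suc (Suc b)) = Suc (Suc b) * (fact (Suc a) * fact (Suc b) :: nat)"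
      by (simp only: fact_Suc[of "Suc b"] of_nat_id ac_simps)
    also have "\<dots> \<le> Suc (Suc a + b) * fact (Suc a + b)"
      by (rule mult_le_mono[OF _ Suc]) simp
    also have "\<dots> = fact (Suc a + Suc b)" by simp
    finally show ?case .
  qed simp
  from this[of "a - 1" "b - 1"] show ?thesis using assms by simp
qed

text \<open>With the sum of the \<open>c x\<close> fixed, the product is largest when all but one of
  them equal 1; the remaining one is then \<open>sum c X + 1 - card X\<close>.
  \<open>fact_mult_le\<close> is the step that moves the excess of one factor to another.\<close>

lemma prod_fact_le:
  assumes "finite X" "X \<noteq> {}" "\<And>x. x \<in> X \<Longrightarrow> c x \<ge> 1"
  shows "(\<Prod>x\<in>X. fact (c x)) \<le> (fact (sum c X + 1 - card X) :: nat)"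
  using assms
proof (induction X rule: finite_ne_induct)
  case (insert x X)
  have "card X \<le> sum c X"
    using sum_bounded_below[of X 1 c] insert by simp
  have "(\<Prod>x\<in>insert x X. fact (c x)) \<le> fact (c x) * (fact (sum c X + 1 - card X) :: nat)"
    using insert by simp
  also have "\<dots> \<le> fact (c x + (sum c X + 1 - card X) - 1)"
    using insert \<open>card X \<le> sum c X\<close> by (intro fact_mult_le) auto
  also have "c x + (sum c X + 1 - card X) - 1 = sum c (insert x X) + 1 - card (insert x X)"
    using insert \<open>card X \<le> sum c X\<close> by simp
  finally show ?case .
qed simp

text \<open>The falling factorial is multiplied by itself in reverse order. Each pair consists of
  positive integers with sum \<open>2 * n - j + 1\<close>, which is at least \<open>n + 1\<close>,
  so its product is at least \<open>n\<close>.\<close>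

lemma prod_top_power_le:
  assumes "j \<le> n"
  shows "n ^ j \<le> (\<Prod>i<j. n - i) ^ 2"
proof -
  have "(\<Prod>i<j. n - i) = (\<Prod>i<j. n - (j - Suc i))"
    by (rule prod.nat_diff_reindex[symmetric])
  then have "(\<Prod>i<j. n - i) ^ 2 = (\<Prod>i<j. (n - i) * (n - (j - Suc i)))"
    by (simp add: power2_eq_square prod.distrib)
  moreover have "(\<Prod>i<j. n) \<le> (\<Prod>i<j. (n - i) * (n - (j - Suc i)))"
  proof (rule prod_mono, safe)
    fix i assume "i < j"
    then obtain a b where "n - i = Suc a" "n - (j - Suc i) = Suc b" "n \<le> Suc (a + b)"
      using assms that[of "n - i - 1" "n - (j - Suc i) - 1"] by auto
    then show "n \<le> (n - i) * (n - (j - Suc i))" by simp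
  qed
  ultimately show ?thesis by simp
qed

lemma fact_eq_prod_top:
  "j \<le> n \<Longrightarrow> fact n = fact (n - j) * (\<Prod>i<j. n - i :: nat)"
proof (induction j)
  case (Suc j)
  then have "fact (n - j) = (n - j) * (fact (n - Suc j) :: nat)"
    by (metis Suc_diff_Suc Suc_le_lessD fact_Suc of_nat_id)
  then show ?case using Suc by simp
qed simp

text \<open>With \<open>j + 1\<close> distinct colours, the factorials of the multiplicities
  multiply to at most \<open>fact (size A - j)\<close>. The multinomial coefficient is therefore at
  least the falling factorial with \<open>j\<close> factors.\<close>

lemma power_le_card_permutations_of_multiset:
  assumes "A \<noteq> {#}"
  shows "size A ^ (card (set_mset A) - 1) \<le> card (permutations_of_multiset A) ^ 2"
proof -
  define j where "j = card (set_mset A) - 1"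
  have c: "card (set_mset A) \<ge> 1" using assms by (simp add: Suc_leI card_gt_0_iff)
  have cs: "card (set_mset A) \<le> size A"
    using sum_bounded_below[of "set_mset A" 1 "count A"] by (simp add: size_multiset_overloaded_eq)
  have "(\<Prod>x\<in>set_mset A. fact (count A x)) \<le> (fact (sum (count A) (set_mset A) + 1 - card (set_mset A)) :: nat)"
    using assms by (intro prod_fact_le) (auto simp: Suc_le_eq)
  also have "sum (count A) (set_mset A) + 1 - card (set_mset A) = size A - j"
    using c cs by (simp add: size_multiset_overloaded_eq[symmetric] j_def)
  finally have le: "(\<Prod>x\<in>set_mset A. fact (count A x)) \<le> (fact (size A - j) :: nat)" .
  have "fact (size A - j) * (\<Prod>i<j. size A - i) = fact (size A)"
    using cs by (intro fact_eq_prod_top[symmetric]) (simp add: j_def)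
  also have "\<dots> = (\<Prod>x\<in>set_mset A. fact (count A x)) * card (permutations_of_multiset A)"
    using card_permutations_of_multiset[of A] by simp
  also have "\<dots> \<le> fact (size A - j) * card (permutations_of_multiset A)"
    by (rule mult_le_mono1[OF le])
  finally have "(\<Prod>i<j. size A - i) \<le> card (permutations_of_multiset A)"
    by simp
  then have "(\<Prod>i<j. size A - i) ^ 2 \<le> card (permutations_of_multiset A) ^ 2"
    by (rule power_mono) simp
  moreover have "size A ^ j \<le> (\<Prod>i<j. size A - i) ^ 2"
    using cs by (intro prod_top_power_le) (simp add: j_def)
  ultimately show ?thesis
    unfolding j_def by (rule order_trans[rotated])
qed


section \<open>Summing over multisets by their number of distinct colours\<close>

text \<open>A multiset is determined by the graph of its multiplicities on its support, an
  \<open>r\<close>-element subset of \<open>S \<times> {1..n}\<close>.\<close>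

lemma card_multisets_le:
  fixes S :: "'a set"
  assumes "finite S"
  shows "finite {A. size A = n \<and> set_mset A \<subseteq> S \<and> card (set_mset A) = r}"
    and "card {A. size A = n \<and> set_mset A \<subseteq> S \<and> card (set_mset A) = r} \<le> (card S * n) ^ r"
proof -
  let ?X = "{A. size A = n \<and> set_mset A \<subseteq> S \<and> card (set_mset A) = r}"
  let ?Y = "{T. T \<subseteq> S \<times> {1..n} \<and> card T = r}"
  let ?g = "\<lambda>A. (\<lambda>x. (x, count A x)) ` set_mset A"
  have fin: "finite ?Y" using assms by simp
  have *: "count B x = count A x" if "?g A = ?g B" "x \<in># A" for A B :: "'a multiset" and x
  proof -
    have "(x, count A x) \<in> ?g B" using that(2) unfolding that(1)[symmetric] by blast
    then show ?thesis by auto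
  qed
  have inj: "inj_on ?g ?X"
  proof (rule inj_onI, rule multiset_eqI)
    fix A B :: "'a multiset" and x assume eq: "?g A = ?g B"
    show "count A x = count B x"
    proof (cases "x \<in># A \<or> x \<in># B")
      case True
      then show ?thesis using *[OF eq] *[OF eq[symmetric]] by fastforce
    next
      case False
      then show ?thesis by (simp add: not_in_iff)
    qed
  qed
  have sub: "?g ` ?X \<subseteq> ?Y"
    by (auto simp: card_image inj_on_def Suc_le_eq count_le_size)
  show "finite ?X" by (rule inj_on_finite[OF inj sub fin])
  have "card ?X \<le> card ?Y" by (rule card_inj_on_le[OF inj sub fin])
  also have "\<dots> = (card S * n) choose r" using assms by (simp add: n_subsets card_cartesian_product)
  also have "\<dots> \<le> (card S * n) ^ r"
    by (cases "r \<le> card S * n") (auto intro: binomial_le_pow simp: binomial_eq_0)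
  finally show "card ?X \<le> (card S * n) ^ r" .
qed

text \<open>The general bound would give \<open>card S * n\<close>. The monochromatic multisets are
  the main term, where the factor \<open>n\<close> cannot be afforded.\<close>

lemma card_multisets_one_le:
  assumes "finite S"
  shows "card {A. size A = n \<and> set_mset A \<subseteq> S \<and> card (set_mset A) = 1} \<le> card S"
proof -
  have "{A. size A = n \<and> set_mset A \<subseteq> S \<and> card (set_mset A) = 1} \<subseteq> replicate_mset n ` S"
  proof clarsimp
    fix A assume A: "set_mset A \<subseteq> S" "card (set_mset A) = Suc 0" "n = size A"
    then obtain x where x: "set_mset A = {x}" by (auto simp: card_1_singleton_iff)
    then have "A = replicate_mset (size A) x"
      by (metis set_mset_subset_singletonD subset_refl)
    then show "A \<in> replicate_mset (size A) ` S" using A x by auto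
  qed
  then show ?thesis using assms by (meson card_image_le card_mono finite_imageI le_trans)
qed

text \<open>The multisets are grouped by their number \<open>r\<close> of distinct colours. Raising
  the bound \<open>n ^ (r - 1)\<close> for the squared multinomial coefficient to the power
  \<open>p\<close> controls each term, which explains the exponent \<open>2 * p\<close>.\<close>

lemma sum_inverse_card_permutations_le:
  fixes S :: "'a set" and \<delta> :: real
  assumes S: "finite S" and n: "n \<ge> 1" and \<delta>: "0 \<le> \<delta>" "\<delta> \<le> 1"
    and p: "2 * real (card S) * real n ^ 2 \<le> \<delta> * real n ^ p"
  shows "(\<Sum>A | size A = n \<and> set_mset A \<subseteq> S. 1 / real (card (permutations_of_multiset A)) ^ (2 * p))
    \<le> card S * (1 + \<delta>)"
proof -
  let ?M = "\<lambda>A::'a multiset. card (permutations_of_multiset A)"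
  define X where "X r = {A. size A = n \<and> set_mset A \<subseteq> S \<and> card (set_mset A) = r}" for r
  \<comment> \<open>\<open>w\<close> is the decay of a term per additional colour and
    \<open>y\<close> the ratio of the resulting geometric series. The hypothesis \<open>p\<close>
    amounts to \<open>2 * y * n \<le> \<delta>\<close>, and this quantity is the final relative
    excess.\<close>
  define q w y where "q = real (card S)" and "w = 1 / real n ^ p" and "y = q * n * w"
  have w0: "w \<ge> 0" "q \<ge> 0" by (auto simp: w_def q_def)
  have np: "real n ^ p > 0" using n by simp
  have qw: "2 * q * real n ^ 2 * w \<le> \<delta>"
    using p np by (simp add: w_def q_def field_simps)
  then have "2 * y * n \<le> \<delta>" by (simp add: y_def power2_eq_square ac_simps)
  moreover have y0: "y \<ge> 0" using w0 by (simp add: y_def)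
  moreover have "2 * y * 1 \<le> 2 * y * n" using n y0 by (intro mult_left_mono) auto
  ultimately have y1: "y \<le> 1 / 2" and yn: "2 * y * n \<le> \<delta>" using \<delta> by auto
  have X1: "finite (X r)" for r unfolding X_def by (rule card_multisets_le[OF S])
  have X2: "card (X r) \<le> (card S * n) ^ r" for r unfolding X_def by (rule card_multisets_le[OF S])
  have X3: "card (X 1) \<le> card S" unfolding X_def by (rule card_multisets_one_le[OF S])
  have term_le: "1 / real (?M A) ^ (2 * p) \<le> w ^ (r - 1)" if "A \<in> X r" for A r
  proof -
    have "A \<noteq> {#}" "size A = n" using that n by (auto simp: X_def)
    then have "n ^ (r - 1) \<le> ?M A ^ 2"
      using power_le_card_permutations_of_multiset[of A] that by (simp add: X_def)
    then have "(n ^ (r - 1)) ^ p \<le> (?M A ^ 2) ^ p" by (rule power_mono) simp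
    then have "real ((n ^ (r - 1)) ^ p) \<le> real ((?M A ^ 2) ^ p)" by (simp only: of_nat_le_iff)
    then have "(real n ^ p) ^ (r - 1) \<le> real (?M A) ^ (2 * p)"
      by (simp add: power_mult[symmetric] mult.commute)
    moreover have "(real n ^ p) ^ (r - 1) > 0" using n by simp
    ultimately show ?thesis
      by (simp add: w_def power_one_over frac_le)
  qed
  have "{A. size A = n \<and> set_mset A \<subseteq> S} = (\<Union>r\<in>{1..n}. X r)"
  proof -
    have "card (set_mset A) \<le> size A \<and> 1 \<le> card (set_mset A)" if "size A \<ge> 1" for A :: "'a multiset"
      using sum_bounded_below[of "set_mset A" 1 "count A"] that
      by (auto simp: size_multiset_overloaded_eq Suc_le_eq card_gt_0_iff)
    then have "card (set_mset A) \<in> {1..n} \<and> A \<in> X (card (set_mset A))"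
      if "size A = n" "set_mset A \<subseteq> S" for A
      using that n by (auto simp: X_def)
    then show ?thesis unfolding X_def by blast
  qed
  then have "(\<Sum>A | size A = n \<and> set_mset A \<subseteq> S. 1 / real (?M A) ^ (2 * p))
    = (\<Sum>r\<in>{1..n}. \<Sum>A\<in>X r. 1 / real (?M A) ^ (2 * p))"
    using X1 by (simp only:) (rule sum.UNION_disjoint, auto simp: X_def simp del: One_nat_def)
  also have "\<dots> \<le> (\<Sum>r\<in>{1..n}. real (card (X r)) * w ^ (r - 1))"
    by (intro sum_mono sum_bounded_above term_le)
  also have "{1..n} = insert 1 {2..n}" using n by auto
  also have "(\<Sum>r\<in>insert 1 {2..n}. real (card (X r)) * w ^ (r - 1))
    = real (card (X 1)) + (\<Sum>r\<in>{2..n}. real (card (X r)) * w ^ (r - 1))" by simp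
  \<comment> \<open>For \<open>r \<ge> 2\<close> the bound is
    \<open>(q * n) ^ r * w ^ (r - 1) = q * n * y ^ (r - 1)\<close>. One factor \<open>y\<close> is
    kept because it carries the smallness; the others are replaced by 1/2.\<close>
  also have "\<dots> \<le> q + (\<Sum>r\<in>{2..n}. (q * n) * y * (1/2) ^ (r - 2))"
  proof (intro add_mono sum_mono)
    show "real (card (X 1)) \<le> q" using X3 by (simp add: q_def)
    fix r assume "r \<in> {2..n}"
    then have "r = Suc (Suc (r - 2))" unfolding atLeastAtMost_iff by arith
    then obtain k where k: "r = Suc (Suc k)" by blast
    have "real (card (X r)) \<le> (q * n) ^ r"
      using of_nat_mono[OF X2[of r], where 'a = real] by (simp add: q_def)
    then have "real (card (X r)) * w ^ (r - 1) \<le> (q * n) ^ r * w ^ (r - 1)"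
      using w0 by (intro mult_right_mono) auto
    also have "\<dots> = (q * n) * y * y ^ k" by (simp add: k y_def power_mult_distrib ac_simps)
    also have "\<dots> \<le> (q * n) * y * (1/2) ^ k"
      using y0 y1 w0 by (intro mult_left_mono power_mono) auto
    finally show "real (card (X r)) * w ^ (r - 1) \<le> (q * n) * y * (1/2) ^ (r - 2)" by (simp add: k)
  qed
  also have "(\<Sum>r\<in>{2..n}. (q * n) * y * (1/2) ^ (r - 2)) = (q * n) * y * (\<Sum>r\<in>{2..n}. (1/2) ^ (r - 2))"
    by (simp add: sum_distrib_left)
  also have "q + (q * n) * y * (\<Sum>r\<in>{2..n}. (1/2) ^ (r - 2)) \<le> q + (q * n) * y * 2"
  proof (intro add_mono mult_left_mono order_refl)
    have "(\<Sum>r\<in>{2..n}. (1/2::real) ^ (r - 2)) = (\<Sum>k<n - 1. (1/2) ^ k)"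
      by (rule sum.reindex_bij_witness[of _ "\<lambda>k. k + 2" "\<lambda>r. r - 2"]) auto
    also have "\<dots> \<le> (\<Sum>k. (1/2) ^ k)" by (intro sum_le_suminf) (auto simp: summable_geometric)
    finally show "(\<Sum>r\<in>{2..n}. (1/2::real) ^ (r - 2)) \<le> 2" by (simp add: suminf_geometric)
  qed (use w0 y0 in auto)
  also have "q + (q * n) * y * 2 = q * (1 + 2 * y * n)" by (simp add: algebra_simps)
  also have "\<dots> \<le> q * (1 + \<delta>)" using yn w0 by (intro mult_left_mono) auto
  finally show ?thesis by (simp add: q_def)
qed

subsection \<open>The expected number of colourings\<close>

text \<open>Edge \<open>e\<close> ends at vertex \<open>e div m\<close>, so every vertex colour is
  seen by exactly \<open>m\<close> edges.\<close>

lemma mset_blow_up: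
  "mset (map (\<lambda>e. f (e div m)) [0..<m * n]) = repeat_mset m (mset (map f [0..<n]))"
proof (induction n)
  case (Suc n)
  have "map (\<lambda>e. f (e div m)) [m * n..<m * n + m] = map (\<lambda>_. f n) [m * n..<m * n + m]"
    by (intro map_cong refl) (auto simp: div_nat_eqI)
  then have "mset (map (\<lambda>e. f (e div m)) [m * n..<m * n + m]) = replicate_mset m (f n)"
    by (simp add: map_replicate_const)
  moreover have "[0..<m * Suc n] = [0..<m * n] @ [m * n..<m * n + m]"
    using upt_add_eq_append[of 0 "m * n" m] by (simp add: add.commute)
  ultimately have "mset (map (\<lambda>e. f (e div m)) [0..<m * Suc n])
    = repeat_mset m (mset (map f [0..<n])) + replicate_mset m (f n)"
    using Suc by (simp only: map_append mset_append)
  then show ?case by simp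
qed simp

lemma card_PiE_mset_le:
  "card {f \<in> {..<n} \<rightarrow>\<^sub>E S. mset (map f [0..<n]) = A} \<le> card (permutations_of_multiset A)"
proof (rule card_inj_on_le)
  show "inj_on (\<lambda>f. map f [0..<n]) {f \<in> {..<n} \<rightarrow>\<^sub>E S. mset (map f [0..<n]) = A}"
  proof (rule inj_onI)
    fix f g assume fg: "f \<in> {f \<in> {..<n} \<rightarrow>\<^sub>E S. mset (map f [0..<n]) = A}"
      "g \<in> {f \<in> {..<n} \<rightarrow>\<^sub>E S. mset (map f [0..<n]) = A}" "map f [0..<n] = map g [0..<n]"
    then have "f i = g i" if "i \<in> {..<n}" for i using that by auto
    then show "f = g" using fg(1,2) by (intro PiE_ext[where k = "{..<n}"]) auto
  qed
  show "(\<lambda>f. map f [0..<n]) ` {f \<in> {..<n} \<rightarrow>\<^sub>E S. mset (map f [0..<n]) = A} \<subseteq> permutations_of_multiset A"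
    unfolding permutations_of_multiset_def by blast
qed simp

text \<open>The sums over permutations and colourings are exchanged. For a colour multiset with
  multinomial coefficient \<open>M\<close> there are at most \<open>M\<close> choices for each of
  \<open>f\<close> and \<open>g\<close>, and a fraction of at most \<open>1 / M ^ m\<close> of the
  permutations respects a given pair. The condition on \<open>m\<close> makes the product at most
  \<open>1 / M ^ (2 * p)\<close>.\<close>

lemma sum_card_colourings_le:
  fixes S :: "'a set" and \<delta> :: real
  assumes S: "finite S" and n: "n \<ge> 1" and \<delta>: "0 \<le> \<delta>" "\<delta> \<le> 1"
    and p: "2 * real (card S) * real n ^ 2 \<le> \<delta> * real n ^ p" and m: "m \<ge> 2 * p + 2"
  shows "(\<Sum>\<sigma> | \<sigma> permutes {..<m * n}.
      real (card (colourings S n (\<lambda>e. e div m) (\<lambda>e. inv_into UNIV \<sigma> e div m) (m * n))))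
    \<le> fact (m * n) * card S * (1 + \<delta>)"
proof -
  define P where "P = {\<sigma>. \<sigma> permutes {..<m * n}}"
  define Fs where "Fs = ({..<n} \<rightarrow>\<^sub>E S)"
  define R where "R f = map (\<lambda>e. f (e div m)) [0..<m * n]" for f :: "nat \<Rightarrow> 'a"
  define A where "A f = mset (map f [0..<n])" for f :: "nat \<Rightarrow> 'a"
  define Y where "Y = {A. size A = n \<and> set_mset A \<subseteq> S}"
  let ?M = "\<lambda>A::'a multiset. real (card (permutations_of_multiset A))"
  have finP: "finite P" unfolding P_def by (rule finite_permutations) simp
  have finF: "finite Fs" unfolding Fs_def using S by (intro finite_PiE) auto
  have M1: "?M A \<ge> 1" for A using card_permutations_of_multiset_pos[of A] by linarith
  have finY: "finite Y"
  proof (rule finite_subset)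
    show "Y \<subseteq> mset ` {xs. set xs \<subseteq> S \<and> length xs = n}"
      by (auto simp: Y_def) (metis (mono_tags, lifting) ex_mset image_eqI mem_Collect_eq set_mset_mset size_mset)
  qed (use S in \<open>auto intro: finite_lists_length_eq\<close>)
  have AR: "mset (R f) = repeat_mset m (A f)" for f
    unfolding R_def A_def by (rule mset_blow_up)
  have AY: "A f \<in> Y" if "f \<in> Fs" for f
  proof -
    have "f \<in> {..<n} \<rightarrow>\<^sub>E S" using that unfolding Fs_def .
    then have "f ` {0..<n} \<subseteq> S" by (meson PiE_mem atLeastLessThan_iff image_subsetI lessThan_iff)
    then show ?thesis unfolding A_def Y_def by simp
  qed
  \<comment> \<open>The bound is written as a sum of ones so that the order of summation can be
    exchanged below.\<close>
  have K: "card (colourings S n (\<lambda>e. e div m) (\<lambda>e. inv_into UNIV \<sigma> e div m) (m * n))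
      \<le> (\<Sum>_\<in>{(f, g) \<in> Fs \<times> Fs. permute_list \<sigma> (R f) = R g}. 1)" if "\<sigma> \<in> P" for \<sigma>
  proof -
    have \<sigma>: "\<sigma> permutes {..<m * n}" using that by (simp add: P_def)
    \<comment> \<open>The colouring condition at edge \<open>\<sigma> i\<close> compares entry
      \<open>\<sigma> i\<close> of \<open>R f\<close> with entry \<open>i\<close> of
      \<open>R g\<close>.\<close>
    have perm: "permute_list \<sigma> (R f) = R g"
      if *: "\<forall>e<m * n. f (e div m) = g (inv_into UNIV \<sigma> e div m)" for f g
    proof (rule nth_equalityI)
      fix i assume "i < length (permute_list \<sigma> (R f))"
      then have i: "i < m * n" by (simp add: R_def)
      then have "\<sigma> i < m * n" using permutes_in_image[OF \<sigma>] by simp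
      then show "permute_list \<sigma> (R f) ! i = R g ! i"
        using i *[rule_format, of "\<sigma> i"] permutes_inverses(2)[OF \<sigma>, of i] permute_list_nth[of \<sigma> "R f" i] \<sigma>
        by (simp add: R_def)
    qed (simp add: R_def)
    have "colourings S n (\<lambda>e. e div m) (\<lambda>e. inv_into UNIV \<sigma> e div m) (m * n)
        \<subseteq> {(f, g) \<in> Fs \<times> Fs. permute_list \<sigma> (R f) = R g}"
      unfolding colourings_def Fs_def using perm by blast
    moreover have "finite {(f, g) \<in> Fs \<times> Fs. permute_list \<sigma> (R f) = R g}"
      by (rule finite_subset[of _ "Fs \<times> Fs"]) (use finF in auto)
    ultimately show ?thesis by (simp add: card_mono)
  qed
  have X: "real (card {\<sigma> \<in> P. permute_list \<sigma> (R f) = R g})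
      \<le> (if A g = A f then fact (m * n) / ?M (A f) ^ m else 0)" for f g
  proof (cases "A g = A f")
    case True
    have "card {\<sigma> \<in> P. permute_list \<sigma> (R f) = R g} * card (permutations_of_multiset (A f)) ^ m
      \<le> card {\<sigma> \<in> P. permute_list \<sigma> (R f) = R g} * card (permutations_of_multiset (mset (R f)))"
      unfolding AR by (intro mult_le_mono2 card_permutations_of_multiset_power_le)
    also have "\<dots> \<le> fact (m * n)"
      using card_permute_list_eq_le[of "R f" "R g"] by (simp add: P_def R_def)
    finally have "real (card {\<sigma> \<in> P. permute_list \<sigma> (R f) = R g} * card (permutations_of_multiset (A f)) ^ m)
      \<le> real (fact (m * n))" by (simp only: of_nat_le_iff)
    then show ?thesis using True M1[of "A f"]
      by (simp add: pos_le_divide_eq)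
  next
    case False
    then have "mset (R g) \<noteq> mset (R f)" using m by (simp add: AR repeat_mset_cancel1)
    moreover have "mset (permute_list \<sigma> (R f)) = mset (R f)" if "\<sigma> \<in> P" for \<sigma>
      by (rule mset_permute_list) (use that in \<open>simp add: P_def R_def\<close>)
    ultimately have "{\<sigma> \<in> P. permute_list \<sigma> (R f) = R g} = {}"
      by force
    then have "card {\<sigma> \<in> P. permute_list \<sigma> (R f) = R g} = 0" by (simp only: card.empty)
    then show ?thesis using False by simp
  qed
  have "(\<Sum>\<sigma>\<in>P. real (card (colourings S n (\<lambda>e. e div m) (\<lambda>e. inv_into UNIV \<sigma> e div m) (m * n))))
    \<le> (\<Sum>\<sigma>\<in>P. real (\<Sum>_\<in>{(f, g) \<in> Fs \<times> Fs. permute_list \<sigma> (R f) = R g}. 1))"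
    by (intro sum_mono of_nat_mono K)
  also have "\<dots> = (\<Sum>\<sigma>\<in>P. \<Sum>fg\<in>{fg \<in> Fs \<times> Fs. permute_list \<sigma> (R (fst fg)) = R (snd fg)}. 1)"
    by (intro sum.cong) (auto simp: case_prod_beta intro!: arg_cong[where f = card])
  also have "\<dots> = (\<Sum>fg\<in>Fs \<times> Fs. \<Sum>\<sigma>\<in>{\<sigma> \<in> P. permute_list \<sigma> (R (fst fg)) = R (snd fg)}. 1)"
    by (rule sum.swap_restrict) (use finP finF in auto)
  also have "\<dots> = (\<Sum>f\<in>Fs. \<Sum>g\<in>Fs. real (card {\<sigma> \<in> P. permute_list \<sigma> (R f) = R g}))"
    by (simp add: sum.cartesian_product case_prod_beta)
  also have "\<dots> \<le> (\<Sum>f\<in>Fs. \<Sum>g\<in>Fs. if A g = A f then fact (m * n) / ?M (A f) ^ m else 0)"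
    by (intro sum_mono X)
  also have "\<dots> = (\<Sum>f\<in>Fs. real (card {g \<in> Fs. A g = A f}) * (fact (m * n) / ?M (A f) ^ m))"
    using finF by (simp add: sum.If_cases Int_def)
  also have "\<dots> \<le> (\<Sum>f\<in>Fs. ?M (A f) * (fact (m * n) / ?M (A f) ^ m))"
    unfolding A_def Fs_def by (intro sum_mono mult_right_mono of_nat_mono card_PiE_mset_le) auto
  \<comment> \<open>The choice of \<open>g\<close> has given one factor \<open>?M\<close>; grouping
    the \<open>f\<close> by their colour multiset gives the second.\<close>
  also have "\<dots> = (\<Sum>B\<in>Y. \<Sum>f | f \<in> Fs \<and> A f = B. ?M (A f) * (fact (m * n) / ?M (A f) ^ m))"
    by (rule sum.group[symmetric, OF finF finY]) (use AY in auto)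
  also have "\<dots> = (\<Sum>B\<in>Y. real (card {f \<in> Fs. A f = B}) * (?M B * (fact (m * n) / ?M B ^ m)))"
    by (intro sum.cong) auto
  also have "\<dots> \<le> (\<Sum>B\<in>Y. ?M B * (?M B * (fact (m * n) / ?M B ^ m)))"
    unfolding A_def Fs_def by (intro sum_mono mult_right_mono of_nat_mono card_PiE_mset_le) auto
  also have "\<dots> \<le> (\<Sum>B\<in>Y. fact (m * n) * (1 / ?M B ^ (2 * p)))"
  proof (rule sum_mono)
    fix B
    obtain k where k: "m = 2 + 2 * p + k" using m by (metis add.commute le_Suc_ex)
    have "?M B * (?M B * (fact (m * n) / ?M B ^ m)) = fact (m * n) * (1 / ?M B ^ (2 * p)) * (1 / ?M B ^ k)"
      using M1[of B] by (simp add: k power_add power2_eq_square field_simps)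
    also have "\<dots> \<le> fact (m * n) * (1 / ?M B ^ (2 * p)) * 1"
      using M1[of B] by (intro mult_left_mono) auto
    finally show "?M B * (?M B * (fact (m * n) / ?M B ^ m)) \<le> fact (m * n) * (1 / ?M B ^ (2 * p))" by simp
  qed
  also have "\<dots> = fact (m * n) * (\<Sum>B\<in>Y. 1 / ?M B ^ (2 * p))" by (simp add: sum_distrib_left)
  also have "\<dots> \<le> fact (m * n) * (card S * (1 + \<delta>))"
    unfolding Y_def by (intro mult_left_mono sum_inverse_card_permutations_le S n \<delta> p) simp
  finally show ?thesis by (simp add: P_def mult.assoc)
qed

subsection \<open>Collisions and statistical distance\<close>

text \<open>By Cauchy--Schwarz, the squared L1 distance to the uniform distribution is at most
  \<open>card \<Omega>\<close> times the collision probability, minus 1. The L1 distance is twice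
  the statistical distance, whence \<open>4 * \<gamma>\<^sup>2\<close>.\<close>

lemma stat_dist_map_uniform_le:
  fixes \<phi> :: "'a \<Rightarrow> 'b"
  assumes X: "finite X" "X \<noteq> {}" and Om: "finite \<Omega>" "\<phi> ` X \<subseteq> \<Omega>" and \<gamma>: "\<gamma> \<ge> 0"
    and le: "real (card \<Omega>) * real (card {(a, b) \<in> X \<times> X. \<phi> a = \<phi> b}) \<le> (1 + 4 * \<gamma>\<^sup>2) * real (card X) ^ 2"
  shows "stat_dist (map_pmf \<phi> (pmf_of_set X)) (pmf_of_set \<Omega>) \<le> \<gamma>"
proof -
  define c where "c v = card {a \<in> X. \<phi> a = v}" for v
  define p where "p = map_pmf \<phi> (pmf_of_set X)"
  define u where "u = pmf_of_set \<Omega>"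
  define M :: real where "M = card \<Omega>"
  define N :: real where "N = card X"
  have Om0: "\<Omega> \<noteq> {}" using X Om by auto
  have M: "M > 0" and N: "N > 0" using X Om Om0 by (simp_all add: M_def N_def card_gt_0_iff)
  have p: "pmf p v = c v / N" for v
    using X by (simp add: p_def pmf_map measure_pmf_of_set c_def N_def vimage_def Int_def)
  have u: "pmf u v = (if v \<in> \<Omega> then 1 / M else 0)" for v
    using Om Om0 by (simp add: u_def M_def)
  have c0: "c v = 0" if "v \<notin> \<Omega>" for v
  proof -
    have "{a \<in> X. \<phi> a = v} = {}" using that Om(2) by auto
    then show ?thesis unfolding c_def by (simp only: card.empty)
  qed
  have "{(a, b) \<in> X \<times> X. \<phi> a = \<phi> b} = (\<Union>v\<in>\<Omega>. {a \<in> X. \<phi> a = v} \<times> {a \<in> X. \<phi> a = v})"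
    using Om by auto
  also have "card \<dots> = (\<Sum>v\<in>\<Omega>. card ({a \<in> X. \<phi> a = v} \<times> {a \<in> X. \<phi> a = v}))"
    using X Om by (intro card_UN_disjoint) auto
  \<comment> \<open>Collisions are counted by the squares of the fibre sizes.\<close>
  finally have C: "card {(a, b) \<in> X \<times> X. \<phi> a = \<phi> b} = (\<Sum>v\<in>\<Omega>. c v ^ 2)"
    by (simp add: card_cartesian_product power2_eq_square c_def)
  have "(\<Sum>v\<in>\<Omega>. c v) = card X"
    using sum.group[OF X(1) Om, of "\<lambda>_. 1::nat"] by (simp add: c_def)
  then have sc: "(\<Sum>v\<in>\<Omega>. real (c v)) = N"
    unfolding N_def by (metis of_nat_sum)
  let ?d = "\<lambda>v. \<bar>c v / N - 1 / M\<bar>"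
  have "infsum (\<lambda>v. \<bar>pmf p v - pmf u v\<bar>) UNIV = infsum ?d \<Omega>"
    by (rule infsum_cong_neutral) (auto simp: p u c0)
  also have "\<dots> = (\<Sum>v\<in>\<Omega>. ?d v)" using Om by (simp add: infsum_finite)
  finally have sd: "stat_dist p u = 1 / 2 * (\<Sum>v\<in>\<Omega>. ?d v)" by (simp add: stat_dist_def)
  have "(\<Sum>v\<in>\<Omega>. ?d v) ^ 2 \<le> M * (\<Sum>v\<in>\<Omega>. ?d v ^ 2)"
    using sum_squared_le_sum_of_squares[of ?d \<Omega>] Om Om0 by (simp add: M_def mult.commute)
  also have "(\<Sum>v\<in>\<Omega>. ?d v ^ 2) = (\<Sum>v\<in>\<Omega>. real (c v) ^ 2 / N ^ 2 - 2 / (N * M) * c v + 1 / M ^ 2)"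
    by (intro sum.cong refl) (simp add: power2_diff power_divide)
  also have "\<dots> = (\<Sum>v\<in>\<Omega>. real (c v) ^ 2) / N ^ 2 - 2 / (N * M) * N + M * (1 / M ^ 2)"
    by (simp only: sum.distrib sum_subtractf sum_divide_distrib[symmetric] sum_distrib_left[symmetric] sc sum_constant M_def times_divide_eq_right mult_1_right)
  also have "M * \<dots> = M * (\<Sum>v\<in>\<Omega>. real (c v) ^ 2) / N ^ 2 - 1"
    using M N by (simp add: field_simps power2_eq_square)
  also have "M * (\<Sum>v\<in>\<Omega>. real (c v) ^ 2) \<le> (1 + 4 * \<gamma>\<^sup>2) * N ^ 2"
    using le unfolding C M_def N_def by simp
  finally have "(\<Sum>v\<in>\<Omega>. ?d v) ^ 2 \<le> (1 + 4 * \<gamma>\<^sup>2) * N ^ 2 / N ^ 2 - 1"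
    using N by (simp add: divide_right_mono)
  then have "(\<Sum>v\<in>\<Omega>. ?d v) ^ 2 \<le> (2 * \<gamma>) ^ 2"
    using N by (simp add: power_mult_distrib)
  then have "(\<Sum>v\<in>\<Omega>. ?d v) \<le> 2 * \<gamma>"
    by (rule power2_le_imp_le) (use \<gamma> in simp)
  then show ?thesis unfolding p_def[symmetric] u_def[symmetric] sd by simp
qed

lemma block_eq:
  assumes "i < n" "m > 0"
  shows "{e \<in> {..<m * n}. e div m = i} = {m * i..<m * i + m :: nat}"
proof (intro equalityI subsetI)
  fix e assume "e \<in> {e \<in> {..<m * n}. e div m = i}"
  then show "e \<in> {m * i..<m * i + m}"
    using mult_div_mod_eq[of m e] mod_less_divisor[OF assms(2), of e] by auto
next
  fix e assume e: "e \<in> {m * i..<m * i + m}"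
  have "m * Suc i \<le> m * n" using assms by (intro mult_le_mono2) simp
  then show "e \<in> {e \<in> {..<m * n}. e div m = i}" using e by (auto intro!: div_nat_eqI)
qed

section \<open>Cardinalities of vector sets in the additive group\<close>

locale finite_abelian_group = abelian_group F for F :: "nat ring" (structure) +
  assumes finite_carrier: "finite (carrier F)"
begin

abbreviation q :: nat where "q \<equiv> card (carrier F)"

lemma q_pos: "q > 0"
  using finite_carrier by (auto simp: card_gt_0_iff)

lemma finite_vecs: "finite (vecs F N)"
  unfolding vecs_def using finite_carrier by (intro finite_PiE) auto

lemma card_vecs: "card (vecs F N) = q ^ N"
  by (simp add: vecs_def card_PiE)

lemma vecs_in_carrier: "y \<in> vecs F N \<Longrightarrow> e < N \<Longrightarrow> y e \<in> carrier F"
  unfolding vecs_def by (meson PiE_mem lessThan_iff)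

lemma finsum_in_carrier: "y \<in> vecs F N \<Longrightarrow> I \<subseteq> {..<N} \<Longrightarrow> finsum F y I \<in> carrier F"
  by (rule finsum_closed) (auto intro: vecs_in_carrier)

lemma vecs_eqI: "y \<in> vecs F N \<Longrightarrow> z \<in> vecs F N \<Longrightarrow> (\<And>e. e < N \<Longrightarrow> y e = z e) \<Longrightarrow> y = z"
  unfolding vecs_def by (rule PiE_ext) auto

text \<open>Coordinate 0 may be overwritten by an arbitrary element without loss, because the
  prescribed sum recovers its old value.\<close>

lemma card_sum_vecs_le:
  assumes "N > 0"
  shows "card {v \<in> vecs F N. finsum F v {..<N} = a} * q \<le> q ^ N"
proof -
  let ?O = "{v \<in> vecs F N. finsum F v {..<N} = a}"
  have I: "{..<N} = insert 0 {0<..<N}" using assms by auto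
  have "card (?O \<times> carrier F) \<le> card (vecs F N)"
  proof (rule card_inj_on_le)
    show "inj_on (\<lambda>(z, t). z(0 := t)) (?O \<times> carrier F)"
    proof (rule inj_onI, clarify)
      fix z t z' t'
      assume z: "z \<in> vecs F N" "z' \<in> vecs F N" and eq: "z(0 := t) = z'(0 := t')"
        and s: "finsum F z' {..<N} = finsum F z {..<N}"
      have e: "z e = z' e" if "e \<noteq> 0" for e using fun_cong[OF eq, of e] that by simp
      have S: "finsum F z {..<N} = z 0 \<oplus> finsum F z {0<..<N}" if "z \<in> vecs F N" for z
        unfolding I by (rule finsum_insert) (use that vecs_in_carrier[OF that] assms in auto)
      have "finsum F z {0<..<N} = finsum F z' {0<..<N}"
        by (rule finsum_cong') (use e vecs_in_carrier[OF z(2)] in auto)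
      then have "z 0 \<oplus> finsum F z {0<..<N} = z' 0 \<oplus> finsum F z {0<..<N}"
        using s S z by simp
      moreover have "finsum F z {0<..<N} \<in> carrier F" by (rule finsum_in_carrier[OF z(1)]) auto
      ultimately have "z 0 = z' 0"
        using vecs_in_carrier[OF z(1) assms] vecs_in_carrier[OF z(2) assms] by simp
      then have "z = z'" using e by (metis ext)
      then show "z = z' \<and> t = t'" using fun_cong[OF eq, of 0] by simp
    qed
    show "(\<lambda>(z, t). z(0 := t)) ` (?O \<times> carrier F) \<subseteq> vecs F N"
      using assms by (auto simp: vecs_def PiE_def extensional_def)
  qed (rule finite_vecs)
  then show ?thesis by (simp add: card_cartesian_product card_vecs)
qed

text \<open>Any vector can be corrected to have the block sums \<open>x\<close> by changing the
  first entry of each block. The corrected vector and the \<open>n\<close> overwritten entries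
  determine the original.\<close>

lemma card_block_vecs_ge:
  assumes m: "m > 0" and x: "x \<in> vecs F n"
  shows "q ^ (m * n) \<le> card (block_vecs F m n x) * q ^ n"
proof -
  let ?B = "block_vecs F m n x"
  define fix_sum where "fix_sum z = (\<lambda>e\<in>{..<m * n}.
    if e mod m = 0 then x (e div m) \<ominus> finsum F z {e<..<e + m} else z e)" for z
  have fin: "finite ?B" by (rule finite_subset[OF _ finite_vecs[of "m * n"]]) (auto simp: block_vecs_def)
  have lt: "m * i + j < m * n" if "i < n" "j < m" for i j
  proof -
    have "m * Suc i \<le> m * n" using that by (intro mult_le_mono2) simp
    then show ?thesis using that by simp
  qed
  have "card (vecs F (m * n)) \<le> card (?B \<times> vecs F n)"
  proof (rule card_inj_on_le)
    show "inj_on (\<lambda>z. (fix_sum z, \<lambda>i\<in>{..<n}. z (m * i))) (vecs F (m * n))"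
    proof (rule inj_onI, rule vecs_eqI)
      fix z z' e
      assume e: "e < m * n"
        and eq: "(fix_sum z, \<lambda>i\<in>{..<n}. z (m * i)) = (fix_sum z', \<lambda>i\<in>{..<n}. z' (m * i))"
      have eq1: "fix_sum z e = fix_sum z' e" using eq by simp
      have eq2: "(\<lambda>i\<in>{..<n}. z (m * i)) (e div m) = (\<lambda>i\<in>{..<n}. z' (m * i)) (e div m)" using eq by (metis prod.inject)
      show "z e = z' e"
      proof (cases "e mod m = 0")
        case True
        moreover have "e div m < n" using e by (simp add: less_mult_imp_div_less mult.commute)
        ultimately show ?thesis using eq2 by auto
      next
        case False
        then show ?thesis using eq1 e by (simp add: fix_sum_def)
      qed
    qed auto
    show "(\<lambda>z. (fix_sum z, \<lambda>i\<in>{..<n}. z (m * i))) ` vecs F (m * n) \<subseteq> ?B \<times> vecs F n"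
    proof (rule image_subsetI)
      fix z assume z: "z \<in> vecs F (m * n)"
      have "(\<lambda>i\<in>{..<n}. z (m * i)) \<in> vecs F n"
        unfolding vecs_def using lt[of _ 0] m by (auto intro!: restrict_PiE vecs_in_carrier[OF z])
      have tail: "{e<..<e + m} \<subseteq> {..<m * n}" if e: "e < m * n" "e mod m = 0" for e
      proof
        fix k assume k: "k \<in> {e<..<e + m}"
        have "m * (e div m) = e" using mult_div_mod_eq[of m e] e(2) by simp
        moreover have "e div m < n" using e by (simp add: less_mult_imp_div_less mult.commute)
        ultimately show "k \<in> {..<m * n}" using lt[of "e div m" "k - e"] k by auto
      qed
      have c: "fix_sum z e \<in> carrier F" if "e < m * n" for e
      proof -
        have "e div m < n" using that by (simp add: less_mult_imp_div_less mult.commute)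
        then have "x (e div m) \<in> carrier F" by (rule vecs_in_carrier[OF x])
        then show ?thesis
          using that vecs_in_carrier[OF z that] finsum_in_carrier[OF z tail[OF that]]
          by (auto simp: fix_sum_def)
      qed
      have "finsum F (fix_sum z) {m * i..<m * i + m} = x i" if i: "i < n" for i
      proof -
        let ?I = "{m * i<..<m * i + m}"
        have sub: "?I \<subseteq> {..<m * n}" using tail[of "m * i"] lt[OF i m] lt[OF i, of 0] m by simp
        have xi: "x i \<in> carrier F" by (rule vecs_in_carrier[OF x i])
        \<comment> \<open>Only multiples of \<open>m\<close> are overwritten, so the correction
          leaves the rest of the block intact.\<close>
        have nz: "\<not> m dvd e" if e: "e \<in> ?I" for e
        proof
          assume "m dvd e"
          then obtain k where "e = m * k" by (elim dvdE)
          then have "m * i < m * k" "m * k < m * Suc i" using e by auto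
          then have "i < k" "k < Suc i" by (simp_all only: mult_less_cancel1)
          then show False by simp
        qed
        have "{m * i..<m * i + m} = insert (m * i) ?I" using m by auto
        moreover have "finsum F (fix_sum z) (insert (m * i) ?I) = fix_sum z (m * i) \<oplus> finsum F (fix_sum z) ?I"
          by (rule finsum_insert) (use c sub lt[OF i m] lt[OF i, of 0] m in auto)
        moreover have "finsum F (fix_sum z) ?I = finsum F z ?I"
          by (rule finsum_cong') (use nz sub vecs_in_carrier[OF z] in \<open>auto simp: fix_sum_def\<close>)
        moreover have "fix_sum z (m * i) = x i \<ominus> finsum F z ?I"
          using lt[OF i, of 0] m by (simp add: fix_sum_def)
        ultimately show ?thesis
          using xi finsum_in_carrier[OF z sub] by (simp add: a_minus_def a_assoc l_neg)
      qed
      moreover have "fix_sum z \<in> vecs F (m * n)"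
        unfolding vecs_def using c by (intro PiE_I) (auto simp: fix_sum_def)
      ultimately show "(fix_sum z, \<lambda>i\<in>{..<n}. z (m * i)) \<in> ?B \<times> vecs F n"
        using \<open>(\<lambda>i\<in>{..<n}. z (m * i)) \<in> vecs F n\<close> by (simp add: block_vecs_def)
    qed
  qed (use fin finite_vecs in simp)
  then show ?thesis by (simp add: card_cartesian_product card_vecs)
qed

text \<open>The entry \<open>y e\<close> labels an edge from the block of \<open>e\<close> to the
  block of \<open>inv_into UNIV \<sigma> e\<close>, the position to which the permutation moves it.
  The two membership conditions become the sums at the left and the right vertices.\<close>

lemma card_block_vecs_permuted_le:
  assumes \<sigma>: "\<sigma> permutes {..<m * n}" and m: "m > 0"
  shows "card {y \<in> block_vecs F m n x. restrict (\<lambda>j. y (\<sigma> j)) {..<m * n} \<in> block_vecs F m n x} * q ^ (2 * n)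
    \<le> q ^ (m * n) * card (colourings (carrier F) n (\<lambda>e. e div m) (\<lambda>e. inv_into UNIV \<sigma> e div m) (m * n))"
proof -
  let ?B = "block_vecs F m n x" and ?l = "\<lambda>e. e div m" and ?r = "\<lambda>e. inv_into UNIV \<sigma> e div m"
  have inv: "inv_into UNIV \<sigma> e < m * n" if "e < m * n" for e
    using permutes_in_image[OF permutes_inv[OF \<sigma>], of e] that by simp
  have "{y \<in> ?B. restrict (\<lambda>j. y (\<sigma> j)) {..<m * n} \<in> ?B} \<subseteq> flows F n ?l ?r (m * n) x x"
  proof clarify
    fix y assume y: "y \<in> ?B" and y\<sigma>: "restrict (\<lambda>j. y (\<sigma> j)) {..<m * n} \<in> ?B"
    have yv: "y \<in> vecs F (m * n)" using y by (simp add: block_vecs_def)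
    have "finsum F y {e \<in> {..<m * n}. ?r e = i} = x i" if i: "i < n" for i
    proof -
      let ?I = "{m * i..<m * i + m}"
      have I: "e < m * n" if "e \<in> ?I" for e
        using that unfolding block_eq[OF i m, symmetric] by simp
      have "{e \<in> {..<m * n}. ?r e = i} = \<sigma> ` ?I"
      proof (intro equalityI subsetI)
        fix e assume "e \<in> {e \<in> {..<m * n}. ?r e = i}"
        then have "inv_into UNIV \<sigma> e \<in> ?I"
          unfolding block_eq[OF i m, symmetric] using inv by simp
        then show "e \<in> \<sigma> ` ?I" using permutes_inverses(1)[OF \<sigma>] by (metis image_eqI)
      next
        fix e assume "e \<in> \<sigma> ` ?I"
        then obtain k where "k \<in> ?I" "e = \<sigma> k" by blast
        then show "e \<in> {e \<in> {..<m * n}. ?r e = i}"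
          using permutes_in_image[OF \<sigma>, of k] permutes_inverses(2)[OF \<sigma>, of k]
          unfolding block_eq[OF i m, symmetric] by simp
      qed
      then have "finsum F y {e \<in> {..<m * n}. ?r e = i} = finsum F (\<lambda>j. y (\<sigma> j)) ?I"
        using permutes_in_image[OF \<sigma>] I
        by (simp only:) (intro finsum_reindex permutes_inj_on[OF \<sigma>], auto intro!: vecs_in_carrier[OF yv])
      also have "\<dots> = finsum F (restrict (\<lambda>j. y (\<sigma> j)) {..<m * n}) ?I"
        using permutes_in_image[OF \<sigma>] I
        by (intro finsum_cong') (auto intro!: vecs_in_carrier[OF yv])
      finally show ?thesis using y\<sigma> i by (simp add: block_vecs_def)
    qed
    moreover have "finsum F y {e \<in> {..<m * n}. ?l e = i} = x i" if "i < n" for i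
      using y that unfolding block_eq[OF that m] by (simp add: block_vecs_def)
    ultimately show "y \<in> flows F n ?l ?r (m * n) x x"
      using yv by (simp add: flows_def vecs_def)
  qed
  then have "card {y \<in> ?B. restrict (\<lambda>j. y (\<sigma> j)) {..<m * n} \<in> ?B} \<le> card (flows F n ?l ?r (m * n) x x)"
    by (intro card_mono finite_flows finite_carrier)
  also have "\<dots> * q ^ (2 * n) \<le> q ^ (m * n) * card (colourings (carrier F) n ?l ?r (m * n))"
    using finite_carrier inv by (intro card_flows_le) (auto simp: less_mult_imp_div_less mult.commute)
  finally show ?thesis by simp
qed

lemma finsum_block_vecs:
  assumes m: "m > 0" and x: "x \<in> vecs F n" and y: "y \<in> block_vecs F m n x"
  shows "finsum F y {..<m * n} = finsum F x {..<n}"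
proof -
  have yv: "y \<in> vecs F (m * n)" using y by (simp add: block_vecs_def)
  have block: "finsum F y {e \<in> {..<m * n}. e div m = i} = x i" if "i < n" for i
    using y that unfolding block_eq[OF that m] by (simp add: block_vecs_def)
  have "finsum F x {..<n} = finsum F (\<lambda>i. finsum F y {e \<in> {..<m * n}. e div m = i}) {..<n}"
    by (rule finsum_cong') (use block vecs_in_carrier[OF x] in \<open>auto simp del: mem_Collect_eq\<close>)
  also have "\<dots> = finsum F y {e \<in> {..<m * n}. e div m \<in> {..<n}}"
    by (rule finsum_fibres) (use vecs_in_carrier[OF yv] in auto)
  also have "{e \<in> {..<m * n}. e div m \<in> {..<n}} = {..<m * n}"
    by (auto simp: less_mult_imp_div_less mult.commute)
  finally show ?thesis by simp
qed

text \<open>If \<open>(y, \<pi>)\<close> and \<open>(y', \<pi>')\<close> collide, then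
  \<open>y'\<close> is \<open>y\<close> permuted by
  \<open>\<pi> \<circ> inv_into UNIV \<pi>'\<close>. Hence \<open>\<pi>'\<close>, this quotient and
  \<open>y\<close> determine the collision, and \<open>\<pi>'\<close> accounts for the factor
  \<open>fact N\<close>.\<close>

lemma card_collisions_le:
  fixes N :: nat and P B
  defines "P \<equiv> {\<pi>. \<pi> permutes {..<N}}"
  assumes B: "B \<subseteq> vecs F N"
  shows "card {(a, b) \<in> (B \<times> P) \<times> (B \<times> P).
      (case a of (y, \<pi>) \<Rightarrow> restrict (\<lambda>j. y (\<pi> j)) {..<N}) = (case b of (y, \<pi>) \<Rightarrow> restrict (\<lambda>j. y (\<pi> j)) {..<N})}
    \<le> fact N * (\<Sum>\<sigma>\<in>P. card {y \<in> B. restrict (\<lambda>j. y (\<sigma> j)) {..<N} \<in> B})" (is "card ?C \<le> _")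
proof -
  let ?Y = "\<lambda>\<sigma>. {y \<in> B. restrict (\<lambda>j. y (\<sigma> j)) {..<N} \<in> B}"
  have finB: "finite B" using B finite_vecs by (rule finite_subset)
  have finP: "finite P" unfolding P_def by (rule finite_permutations) simp
  have R: "restrict (\<lambda>j. y ((\<pi> \<circ> inv_into UNIV \<pi>') j)) {..<N} = y'"
    if "y' \<in> B" "\<pi>' \<in> P" and eq: "restrict (\<lambda>j. y (\<pi> j)) {..<N} = restrict (\<lambda>j. y' (\<pi>' j)) {..<N}"
    for y y' \<pi> \<pi>'
  proof (rule extensionalityI[where A = "{..<N}"])
    show "y' \<in> extensional {..<N}" using \<open>y' \<in> B\<close> B by (auto simp: vecs_def PiE_def)
    have \<pi>': "\<pi>' permutes {..<N}" using that by (simp add: P_def)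
    fix e assume e: "e \<in> {..<N}"
    then have i: "inv_into UNIV \<pi>' e \<in> {..<N}"
      using permutes_in_image[OF permutes_inv[OF \<pi>']] by blast
    then show "restrict (\<lambda>j. y ((\<pi> \<circ> inv_into UNIV \<pi>') j)) {..<N} e = y' e"
      using e fun_cong[OF eq, of "inv_into UNIV \<pi>' e"] permutes_inverses(1)[OF \<pi>'] by simp
  qed simp
  let ?g = "\<lambda>((y :: nat \<Rightarrow> nat, \<pi>), (y' :: nat \<Rightarrow> nat, \<pi>')). (\<pi>', \<pi> \<circ> inv_into UNIV \<pi>', y)"
  have "card ?C \<le> card (P \<times> Sigma P ?Y)"
  proof (rule card_inj_on_le)
    show "inj_on ?g ?C"
    proof (rule inj_onI, clarsimp)
      fix y \<pi> y' \<pi>' \<rho> y''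
      assume a: "y' \<in> B" "\<pi>' \<in> P" "y'' \<in> B"
        "restrict (\<lambda>j. y (\<pi> j)) {..<N} = restrict (\<lambda>j. y' (\<pi>' j)) {..<N}"
        "restrict (\<lambda>j. y (\<rho> j)) {..<N} = restrict (\<lambda>j. y'' (\<pi>' j)) {..<N}"
        and eq: "\<pi> \<circ> inv_into UNIV \<pi>' = \<rho> \<circ> inv_into UNIV \<pi>'"
      have "y' = y''" using eq a R[of y' \<pi>' y \<pi>]
          R[of y'' \<pi>' y \<rho>] by metis
      moreover have "\<pi> = \<rho>"
      proof
        fix j
        have "inv_into UNIV \<pi>' (\<pi>' j) = j" using a(2) by (simp add: P_def permutes_inverses)
        then show "\<pi> j = \<rho> j" using fun_cong[OF eq, of "\<pi>' j"] by simp
      qed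
      ultimately show "\<pi> = \<rho> \<and> y' = y''" by simp
    qed
    show "?g ` ?C \<subseteq> P \<times> Sigma P ?Y"
    proof (rule image_subsetI)
      fix c assume c: "c \<in> ?C"
      obtain y \<pi> y' \<pi>' where [simp]: "c = ((y, \<pi>), (y', \<pi>'))" by (metis surj_pair)
      have a: "y \<in> B" "\<pi> \<in> P" "y' \<in> B" "\<pi>' \<in> P"
        "restrict (\<lambda>j. y (\<pi> j)) {..<N} = restrict (\<lambda>j. y' (\<pi>' j)) {..<N}"
        using c by auto
      have "\<pi> \<circ> inv_into UNIV \<pi>' \<in> P"
        using a by (simp add: P_def permutes_compose permutes_inv)
      then show "?g c \<in> P \<times> Sigma P ?Y"
        using R[of y' \<pi>' y \<pi>] a by simp
    qed
  qed (use finB finP in auto)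
  also have "\<dots> = fact N * (\<Sum>\<sigma>\<in>P. card (?Y \<sigma>))"
    using finP finB by (simp add: card_cartesian_product card_SigmaI P_def card_permutations)
  finally show ?thesis .
qed

text \<open>The counting bounds are combined with \<open>\<delta> = \<gamma>\<^sup>2\<close>. The
  factor \<open>q\<close> from the monochromatic colourings is cancelled by the factor
  \<open>q\<close> that the fixed total sum saves in \<open>\<Omega>\<close>.\<close>

lemma stat_dist_le:
  assumes n: "n \<ge> 1" and x: "x \<in> vecs F n" and \<gamma>: "0 \<le> \<gamma>" "\<gamma> \<le> 1"
    and p: "2 * real q * real n ^ 2 \<le> \<gamma>\<^sup>2 * real n ^ p" and m: "m \<ge> 2 * p + 2"
  shows "stat_dist (S_dist F m n x) (U_dist F (m * n) (finsum F x {..<n})) \<le> \<gamma>"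
proof -
  let ?N = "m * n"
  define B where "B = block_vecs F m n x"
  define P where "P = {\<pi>. \<pi> permutes {..<?N}}"
  define \<Omega> where "\<Omega> = {v \<in> vecs F ?N. finsum F v {..<?N} = finsum F x {..<n}}"
  define \<phi> where "\<phi> = (\<lambda>(y :: nat \<Rightarrow> nat, \<pi>). restrict (\<lambda>j. y (\<pi> j)) {..<?N})"
  define T where "T = (\<Sum>\<sigma>\<in>P. card {y \<in> B. restrict (\<lambda>j. y (\<sigma> j)) {..<?N} \<in> B})"
  define C where "C = card {(a, b) \<in> (B \<times> P) \<times> (B \<times> P). \<phi> a = \<phi> b}"
  define K where "K \<sigma> = card (colourings (carrier F) n (\<lambda>e. e div m) (\<lambda>e. inv_into UNIV \<sigma> e div m) ?N)" for \<sigma>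
  have m0: "m > 0" and N: "?N > 0" using m n by auto
  have Bv: "B \<subseteq> vecs F ?N" by (auto simp: B_def block_vecs_def)
  then have finB: "finite B" using finite_vecs by (rule finite_subset)
  have B: "q ^ ?N \<le> card B * q ^ n" unfolding B_def by (rule card_block_vecs_ge[OF m0 x])
  then have B0: "B \<noteq> {}" using q_pos by auto
  have finP: "finite P" unfolding P_def by (rule finite_permutations) simp
  have P0: "P \<noteq> {}" unfolding P_def using permutes_id by blast
  have cP: "card P = fact ?N" unfolding P_def by (simp add: card_permutations)
  have fin\<Omega>: "finite \<Omega>" unfolding \<Omega>_def using finite_vecs by simp
  have \<phi>\<Omega>: "\<phi> ` (B \<times> P) \<subseteq> \<Omega>"
  proof clarify
    fix y \<pi> assume y: "y \<in> B" and "\<pi> \<in> P"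
    then have \<pi>: "\<pi> permutes {..<?N}" by (simp add: P_def)
    have yc: "y e \<in> carrier F" if "e < ?N" for e using vecs_in_carrier y Bv that by blast
    have \<pi>N: "\<pi> j < ?N" if "j < ?N" for j using permutes_in_image[OF \<pi>, of j] that by simp
    have "finsum F (\<phi> (y, \<pi>)) {..<?N} = finsum F (\<lambda>j. y (\<pi> j)) {..<?N}"
      unfolding \<phi>_def by (rule finsum_cong') (use yc \<pi>N in auto)
    also have "\<dots> = finsum F y (\<pi> ` {..<?N})"
      by (rule finsum_reindex[symmetric]) (use permutes_inj_on[OF \<pi>] yc \<pi>N in auto)
    also have "\<dots> = finsum F x {..<n}"
      unfolding permutes_image[OF \<pi>] using y finsum_block_vecs[OF m0 x] by (simp add: B_def)
    moreover have "\<phi> (y, \<pi>) \<in> vecs F ?N"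
      unfolding vecs_def \<phi>_def using yc \<pi>N by (intro PiE_I) auto
    ultimately show "\<phi> (y, \<pi>) \<in> \<Omega>" by (simp add: \<Omega>_def)
  qed
  have \<Omega>: "card \<Omega> * q \<le> q ^ ?N" unfolding \<Omega>_def by (rule card_sum_vecs_le[OF N])
  have CT: "C \<le> fact ?N * T"
    unfolding C_def \<phi>_def T_def P_def by (rule card_collisions_le[OF Bv])
  have TK: "T * q ^ (2 * n) \<le> q ^ ?N * (\<Sum>\<sigma>\<in>P. K \<sigma>)"
    unfolding T_def sum_distrib_left sum_distrib_right K_def B_def
    by (intro sum_mono card_block_vecs_permuted_le m0) (simp add: P_def)
  have SK: "real (\<Sum>\<sigma>\<in>P. K \<sigma>) \<le> fact ?N * q * (1 + \<gamma>\<^sup>2)"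
    unfolding K_def P_def of_nat_sum
    by (rule sum_card_colourings_le[OF finite_carrier n _ _ p m]) (use \<gamma> in \<open>auto simp: power_le_one\<close>)
  \<comment> \<open>Both sides carry the factor \<open>q * q ^ (2 * n)\<close>, so that all bounds
    apply without division; it is cancelled at the end.\<close>
  have "real (card \<Omega> * q * C * q ^ (2 * n)) \<le> real (q ^ ?N * (fact ?N * (q ^ ?N * (\<Sum>\<sigma>\<in>P. K \<sigma>))))"
  proof (rule of_nat_mono)
    have "card \<Omega> * q * C * q ^ (2 * n) \<le> q ^ ?N * (fact ?N * T) * q ^ (2 * n)"
      by (intro mult_le_mono \<Omega> CT order_refl)
    also have "\<dots> = q ^ ?N * (fact ?N * (T * q ^ (2 * n)))" by (simp add: ac_simps)
    also have "\<dots> \<le> q ^ ?N * (fact ?N * (q ^ ?N * (\<Sum>\<sigma>\<in>P. K \<sigma>)))"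
      by (intro mult_le_mono TK order_refl)
    finally show "card \<Omega> * q * C * q ^ (2 * n) \<le> q ^ ?N * (fact ?N * (q ^ ?N * (\<Sum>\<sigma>\<in>P. K \<sigma>)))" .
  qed
  also have "\<dots> = (real q ^ ?N)\<^sup>2 * fact ?N * real (\<Sum>\<sigma>\<in>P. K \<sigma>)"
    by (simp add: power2_eq_square)
  also have "\<dots> \<le> (real q ^ ?N)\<^sup>2 * fact ?N * (fact ?N * q * (1 + \<gamma>\<^sup>2))"
    by (intro mult_left_mono SK) auto
  also have "\<dots> \<le> (real (card B) * real q ^ n)\<^sup>2 * fact ?N * (fact ?N * q * (1 + \<gamma>\<^sup>2))"
  proof (intro mult_right_mono power_mono)
    show "real q ^ ?N \<le> real (card B) * real q ^ n"
      using of_nat_mono[OF B, where 'a = real] by simp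
  qed auto
  also have "\<dots> = (1 + \<gamma>\<^sup>2) * (real (card (B \<times> P)))\<^sup>2 * (real q * real q ^ (2 * n))"
    by (simp add: card_cartesian_product cP power_mult_distrib power2_eq_square mult_2 power_add)
  finally have "(real (card \<Omega>) * real C) * (real q * real q ^ (2 * n))
    \<le> ((1 + \<gamma>\<^sup>2) * (real (card (B \<times> P)))\<^sup>2) * (real q * real q ^ (2 * n))"
    by (simp add: ac_simps)
  then have "real (card \<Omega>) * real C \<le> (1 + \<gamma>\<^sup>2) * (real (card (B \<times> P)))\<^sup>2"
    by (rule mult_right_le_imp_le) (use q_pos in simp)
  also have "\<dots> \<le> (1 + 4 * \<gamma>\<^sup>2) * (real (card (B \<times> P)))\<^sup>2"
    by (intro mult_right_mono) auto
  finally have le: "real (card \<Omega>) * real C \<le> (1 + 4 * \<gamma>\<^sup>2) * (real (card (B \<times> P)))\<^sup>2" .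
  have "pair_pmf (pmf_of_set B) (pmf_of_set P) = pmf_of_set (B \<times> P)"
    by (rule pmf_eqI) (auto simp: pmf_pair finB finP B0 P0 card_cartesian_product indicator_def)
  then have S: "S_dist F m n x = map_pmf \<phi> (pmf_of_set (B \<times> P))"
    by (simp add: S_dist_def \<phi>_def B_def P_def)
  show ?thesis
    unfolding S U_dist_def \<Omega>_def[symmetric]
    by (rule stat_dist_map_uniform_le[OF _ _ fin\<Omega> \<phi>\<Omega> \<gamma>(1) le[unfolded C_def]])
       (use finB finP B0 P0 in auto)
qed

end

section \<open>The choice of the constant\<close>

lemma exponent_large_enough:
  fixes \<gamma> :: real
  assumes n: "n \<ge> 2" and q: "q \<ge> 1" and \<gamma>: "0 < \<gamma>" "\<gamma> < 1"
    and m: "real m \<ge> 10 * (1 + ln (real q / \<gamma>) / ln (real n))"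
  shows "2 * real q * real n ^ 2 \<le> \<gamma>\<^sup>2 * real n ^ ((m - 2) div 2)" and "m \<ge> 2 * ((m - 2) div 2) + 2"
proof -
  define p where "p = (m - 2) div 2"
  define L where "L = ln (real q / \<gamma>) / ln (real n)"
  have q\<gamma>: "real q / \<gamma> \<ge> 1" using q \<gamma> by (simp add: field_simps)
  have ln: "ln (real n) > 0" using n by simp
  have L: "L \<ge> 0" using q\<gamma> ln by (simp add: L_def)
  then have m10: "m \<ge> 10" using m by (simp add: L_def)
  then show "m \<ge> 2 * ((m - 2) div 2) + 2" by presburger
  \<comment> \<open>Subtracting 2 and rounding lose at most 3, so \<open>2 * p\<close> is at least
    \<open>7 + 10 * L\<close>, more than the \<open>6 + 4 * L\<close> required.\<close>
  have "2 * p + 3 \<ge> m" unfolding p_def by presburger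
  then have "2 * real p + 3 \<ge> real m" by linarith
  then have "real p \<ge> 3 + 2 * L" using m L unfolding L_def[symmetric] by argo
  then have "(3 + 2 * L) * ln (real n) \<le> real p * ln (real n)"
    using ln by (intro mult_right_mono) auto
  moreover have "(3 + 2 * L) * ln (real n) = 3 * ln (real n) + 2 * ln (real q / \<gamma>)"
    using ln by (simp add: L_def field_simps)
  moreover have "3 * ln (real n) + 2 * ln (real q / \<gamma>) = ln (real n ^ 3 * (real q / \<gamma>) ^ 2)"
    using n q q\<gamma> by (subst ln_mult) (auto simp: ln_realpow)
  ultimately have "ln (real n ^ 3 * (real q / \<gamma>) ^ 2) \<le> ln (real n ^ p)"
    using n by (simp add: ln_realpow)
  then have "real n ^ 3 * (real q / \<gamma>) ^ 2 \<le> real n ^ p"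
    using n q \<gamma> by (subst (asm) ln_le_cancel_iff) auto
  then have "\<gamma>\<^sup>2 * (real n ^ 3 * (real q / \<gamma>) ^ 2) \<le> \<gamma>\<^sup>2 * real n ^ p"
    by (intro mult_left_mono) auto
  moreover have "\<gamma>\<^sup>2 * (real n ^ 3 * (real q / \<gamma>) ^ 2) = real n * real q * (real q * real n ^ 2)"
    using \<gamma> by (simp add: field_simps power2_eq_square power3_eq_cube)
  \<comment> \<open>The third power of \<open>n\<close> leaves a spare factor
    \<open>n \<ge> 2\<close>, which absorbs the constant 2.\<close>
  moreover have "2 * 1 * (real q * real n ^ 2) \<le> real n * real q * (real q * real n ^ 2)"
    using n q by (intro mult_right_mono mult_mono) auto
  ultimately show "2 * real q * real n ^ 2 \<le> \<gamma>\<^sup>2 * real n ^ ((m - 2) div 2)"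
    by (simp add: p_def)
qed

theorem theorem3:
  shows "\<exists>C::real. C > 0 \<and>
    (\<forall>(F::nat ring) (n::nat) (\<gamma>::real) (m::nat) (x::nat \<Rightarrow> nat).
       field F \<and> finite (carrier F) \<and> n \<ge> 2 \<and> 0 < \<gamma> \<and> \<gamma> < 1 \<and>
       real m \<ge> C * (1 + ln (real (card (carrier F)) / \<gamma>) / ln (real n)) \<and>
       x \<in> vecs F n
       \<longrightarrow> stat_dist (S_dist F m n x) (U_dist F (m * n) (finsum F x {..<n})) \<le> \<gamma>)"
proof (intro exI[of _ 10] conjI allI impI; (elim conjE)?)
  fix F :: "nat ring" and n m :: nat and \<gamma> :: real and x :: "nat \<Rightarrow> nat"
  assume F: "field F" "finite (carrier F)" and n: "n \<ge> 2" and \<gamma>: "0 < \<gamma>" "\<gamma> < 1"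
    and m: "real m \<ge> 10 * (1 + ln (real (card (carrier F)) / \<gamma>) / ln (real n))"
    and x: "x \<in> vecs F n"
  interpret field F by fact
  interpret finite_abelian_group F by unfold_locales fact
  have "card (carrier F) \<ge> 1" using q_pos by simp
  from exponent_large_enough[OF n this \<gamma> m] n \<gamma> x
  show "stat_dist (S_dist F m n x) (U_dist F (m * n) (finsum F x {..<n})) \<le> \<gamma>"
    by (intro stat_dist_le[where p = "(m - 2) div 2"]) auto
qed simp

end
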